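(* Let $X\in\mathbb{R}^{n\times d}$, $Y\in\mathbb{R}^{m\times d}$, let $\sigma:\mathbb{R}\to\mathbb{R}$ be differentiable, and let $$F(W_1,W_0)=\tfrac12\|Y-W_1\sigma(W_0X)\|_F^2,\qquad W_1\in\mathbb{R}^{m\times r},\ W_0\in\mathbb{R}^{r\times n}.$$ Then the gradient of $F$ has the two blocks $$\nabla_{W_1}F(W_1,W_0)=(W_1\sigma(W_0X)-Y)\,\sigma(W_0X)^T,$$ $$\nabla_{W_0}F(W_1,W_0)=\big[\sigma'(W_0X)\circ\big(W_1^T(W_1\sigma(W_0X)-Y)\big)\big]X^T.$$ Moreover, $(W_1,W_0)$ is a first order stationary point of $F$ if and only if one of the following two conditions holds: (1) the misfit is exactly zero, $W_1\sigma(W_0X)=Y$, in which case $(W_1,W_0)$ is a global minimum of $F$; (2) $W_1\sigma(W_0X)\neq Y$, and both $\big[\sigma'(W_0X)\circ\big(W_1^T(W_1\sigma(W_0X)-Y)\big)\big]\perp X^T$ and $(W_1\sigma(W_0X)-Y)\perp\sigma(W_0X)^T$.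
   Context: The function $\sigma$ and its derivative $\sigma'$ are applied to matrices elementwise. $\circ$ is the Hadamard (elementwise) product and $\|\cdot\|_F$ the Frobenius norm. For $A\in\mathbb{R}^{p\times q}$ and $B\in\mathbb{R}^{q\times k}$, $A\perp B$ means that the rows of $A$ are orthogonal to the columns of $B$, i.e. $AB=0$. $\nabla_{W}F$ denotes the matrix of partial derivatives of $F$ with respect to the entries of $W$ (same shape as $W$). A first order stationary point is a point where $\nabla F=0$ (both blocks vanish). A global minimum is a point at which $F$ attains a value less than or equal to its value at every other point. *)

theory Defs
  imports "HOL-Analysis.Analysis"
begin

text \<open>
  A \<open>p \<times> q\<close> real matrix has type \<open>real ^ 'q ^ 'p\<close> (rows indexed by \<open>'p\<close>).
  The library's \<open>norm\<close> at this type is the Frobenius norm: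
\<close>

lemma norm_matrix_eq_frobenius:
  fixes A :: "real ^ 'q ^ 'p"
  shows "norm A = sqrt (\<Sum>i\<in>UNIV. \<Sum>j\<in>UNIV. (A $ i $ j)\<^sup>2)"
  by (simp add: norm_vec_def L2_set_def sum_nonneg)

definition mat_map :: "(real \<Rightarrow> real) \<Rightarrow> real ^ 'q ^ 'p \<Rightarrow> real ^ 'q ^ 'p" where
  "mat_map f A = (\<chi> i j. f (A $ i $ j))"

text \<open>The library's \<open>*\<close> at this type is the Hadamard product; the matrix product is \<open>**\<close>.\<close>

lemma times_matrix_eq_hadamard:
  fixes A B :: "real ^ 'q ^ 'p"
  shows "A * B = (\<chi> i j. A $ i $ j * B $ i $ j)"
  by (simp add: vec_eq_iff)

definition mat_orthogonal :: "real ^ 'q ^ 'p \<Rightarrow> real ^ 'k ^ 'q \<Rightarrow> bool" where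
  "mat_orthogonal A B \<longleftrightarrow> (\<forall>i j. orthogonal (row i A) (column j B))"

lemma mat_orthogonal_iff: "mat_orthogonal A B \<longleftrightarrow> A ** B = 0"
  by (simp add: mat_orthogonal_def orthogonal_def row_def column_def inner_vec_def
      matrix_matrix_mult_def vec_eq_iff)

definition mat_upd :: "real ^ 'q ^ 'p \<Rightarrow> 'p \<Rightarrow> 'q \<Rightarrow> real \<Rightarrow> real ^ 'q ^ 'p" where
  "mat_upd W i j t = (\<chi> k l. if k = i \<and> l = j then t else W $ k $ l)"

text \<open>
  \<open>has_mat_gradient F G W\<close>: all partial derivatives of \<open>F\<close> with respect to the matrix entries
  exist at \<open>W\<close>, and \<open>G\<close> is the matrix they form. As a relation it does not assign a gradient
  where a partial derivative fails to exist.
\<close>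

definition has_mat_gradient ::
    "(real ^ 'q ^ 'p \<Rightarrow> real) \<Rightarrow> real ^ 'q ^ 'p \<Rightarrow> real ^ 'q ^ 'p \<Rightarrow> bool" where
  "has_mat_gradient F G W \<longleftrightarrow>
     (\<forall>i j. ((\<lambda>t. F (mat_upd W i j t)) has_real_derivative G $ i $ j) (at (W $ i $ j)))"

lemma has_mat_gradient_unique:
  assumes "has_mat_gradient F G W" "has_mat_gradient F H W"
  shows "G = H"
  using assms unfolding has_mat_gradient_def vec_eq_iff by (blast intro: DERIV_unique)

definition first_order_stationary ::
    "(real ^ 'q ^ 'p \<Rightarrow> real ^ 'l ^ 'k \<Rightarrow> real) \<Rightarrow> real ^ 'q ^ 'p \<Rightarrow> real ^ 'l ^ 'k \<Rightarrow> bool" where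
  "first_order_stationary F W1 W0 \<longleftrightarrow>
     has_mat_gradient (\<lambda>V. F V W0) 0 W1 \<and> has_mat_gradient (\<lambda>V. F W1 V) 0 W0"

definition global_minimum ::
    "(real ^ 'q ^ 'p \<Rightarrow> real ^ 'l ^ 'k \<Rightarrow> real) \<Rightarrow> real ^ 'q ^ 'p \<Rightarrow> real ^ 'l ^ 'k \<Rightarrow> bool" where
  "global_minimum F W1 W0 \<longleftrightarrow> (\<forall>V1 V0. F W1 W0 \<le> F V1 V0)"

definition loss ::
    "(real \<Rightarrow> real) \<Rightarrow> real ^ 'd ^ 'n \<Rightarrow> real ^ 'd ^ 'm \<Rightarrow> real ^ 'r ^ 'm \<Rightarrow> real ^ 'n ^ 'r \<Rightarrow> real" where
  "loss \<sigma> X Y W1 W0 = 1 / 2 * (norm (Y - W1 ** mat_map \<sigma> (W0 ** X)))\<^sup>2"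

end

theory Submission
  imports Defs
begin

text \<open>Both gradient blocks come from the chain rule applied to half the sum of squared
  residual entries, one matrix entry at a time. Moving entry (i, j) of a left factor changes only
  row i of a product, and affinely (\<open>mat_upd_mult_nth\<close>). For \<open>W1\<close> this is
  already the residual up to sign; for \<open>W0\<close> it passes through \<open>\<sigma>\<close>
  and then through the linear map \<open>W1\<close>, which produces the factor
  \<open>deriv \<sigma>\<close> and the transpose of \<open>W1\<close>. Since gradients are unique,
  stationarity says that both explicit products vanish, which is what the two orthogonality
  conditions mean. A zero residual makes both products vanish, so the dichotomy only separates out
  that case; there the nonnegative loss is 0, hence minimal.\<close>

lemma mat_upd_same: "mat_upd W i j (W $ i $ j) = W"
  by (simp add: mat_upd_def vec_eq_iff)

lemma mat_upd_mult_nth: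
  "(mat_upd W i j t ** B) $ k $ l =
     (W ** B) $ k $ l + (if k = i then (t - W $ i $ j) * B $ j $ l else 0)"
proof -
  \<comment> \<open>Each summand is the old one plus a correction supported at \<open>q = j\<close>,
    so the sum of the corrections collapses.\<close>
  have "(mat_upd W i j t ** B) $ k $ l =
      (\<Sum>q\<in>UNIV. W $ k $ q * B $ q $ l +
         (if q = j then if k = i then (t - W $ i $ j) * B $ j $ l else 0 else 0))"
    unfolding matrix_matrix_mult_def mat_upd_def vec_lambda_beta
    by (intro sum.cong) (auto simp: algebra_simps)
  then show ?thesis
    by (simp add: sum.distrib matrix_matrix_mult_def)
qed

text \<open>The squared Frobenius norm is a finite sum of squares, so entrywise derivatives of the
  residual suffice; the factor 1/2 cancels the 2 from each square.\<close>

lemma DERIV_half_norm_power2_matrix: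
  fixes R :: "real \<Rightarrow> real ^ 'q ^ 'p"
  assumes "\<And>k l. ((\<lambda>t. R t $ k $ l) has_real_derivative D k l) (at x)"
  shows "((\<lambda>t. 1 / 2 * (norm (R t))\<^sup>2) has_real_derivative
          (\<Sum>k\<in>UNIV. \<Sum>l\<in>UNIV. R x $ k $ l * D k l)) (at x)"
proof -
  have "(\<lambda>t. 1 / 2 * (norm (R t))\<^sup>2) = (\<lambda>t. \<Sum>k\<in>UNIV. \<Sum>l\<in>UNIV. 1 / 2 * (R t $ k $ l)\<^sup>2)"
    by (simp add: norm_matrix_eq_frobenius sum_nonneg sum_distrib_left)
  moreover have "((\<lambda>t. 1 / 2 * (R t $ k $ l)\<^sup>2) has_real_derivative R x $ k $ l * D k l) (at x)" for k l
    by (auto intro!: derivative_eq_intros assms)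
  ultimately show ?thesis
    by (auto intro!: DERIV_sum)
qed

lemma loss_gradient_outer:
  fixes W1 :: "real ^ 'r ^ 'm"
  shows "has_mat_gradient (\<lambda>V. loss \<sigma> X Y V W0)
    ((W1 ** mat_map \<sigma> (W0 ** X) - Y) ** transpose (mat_map \<sigma> (W0 ** X))) W1"
  unfolding has_mat_gradient_def loss_def
proof (intro allI)
  fix i :: 'm and j :: 'r
  define S where "S = mat_map \<sigma> (W0 ** X)"
  have "((\<lambda>t. (Y - mat_upd W1 i j t ** S) $ k $ l) has_real_derivative
      (if k = i then - S $ j $ l else 0)) (at (W1 $ i $ j))" for k l
    by (auto simp: mat_upd_mult_nth intro!: derivative_eq_intros)
  note DERIV_half_norm_power2_matrix[OF this]
  \<comment> \<open>The minus sign turns \<open>Y - W1 ** S\<close> into \<open>W1 ** S - Y\<close>;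
    with the condition pulled out of the inner sum, only row \<open>i\<close> survives.\<close>
  moreover have "(\<Sum>k\<in>UNIV. \<Sum>l\<in>UNIV. (Y - W1 ** S) $ k $ l * (if k = i then - S $ j $ l else 0)) =
      (\<Sum>k\<in>UNIV. if k = i then \<Sum>l\<in>UNIV. (W1 ** S - Y) $ k $ l * S $ j $ l else 0)"
    by (intro sum.cong) (auto simp: algebra_simps intro!: sum.cong)
  then have "(\<Sum>k\<in>UNIV. \<Sum>l\<in>UNIV. (Y - W1 ** S) $ k $ l * (if k = i then - S $ j $ l else 0)) =
      ((W1 ** S - Y) ** transpose S) $ i $ j"
    by (simp add: matrix_matrix_mult_def[of "W1 ** S - Y"] transpose_def)
  ultimately show "((\<lambda>t. 1 / 2 * (norm (Y - mat_upd W1 i j t ** mat_map \<sigma> (W0 ** X)))\<^sup>2)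
      has_real_derivative ((W1 ** mat_map \<sigma> (W0 ** X) - Y) ** transpose (mat_map \<sigma> (W0 ** X))) $ i $ j)
      (at (W1 $ i $ j))"
    by (simp add: S_def mat_upd_same)
qed

lemma loss_gradient_inner:
  fixes X :: "real ^ 'd ^ 'n" and W1 :: "real ^ 'r ^ 'm" and W0 :: "real ^ 'n ^ 'r"
  assumes diff: "\<And>x. \<sigma> differentiable (at x)"
  shows "has_mat_gradient (\<lambda>V. loss \<sigma> X Y W1 V)
    ((mat_map (deriv \<sigma>) (W0 ** X) *
       (transpose W1 ** (W1 ** mat_map \<sigma> (W0 ** X) - Y))) ** transpose X) W0"
  unfolding has_mat_gradient_def loss_def
proof (intro allI)
  fix i :: 'r and j :: 'n
  define P where "P = W1 ** mat_map \<sigma> (W0 ** X)"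
  define D where "D = mat_map (deriv \<sigma>) (W0 ** X)"
  have \<sigma>: "(\<sigma> has_real_derivative deriv \<sigma> x) (at x)" for x
    using diff by (simp add: DERIV_deriv_iff_real_differentiable)
  have hidden: "((\<lambda>t. \<sigma> ((mat_upd W0 i j t ** X) $ q $ l)) has_real_derivative
      (if q = i then D $ i $ l * X $ j $ l else 0)) (at (W0 $ i $ j))" for q l
  proof (rule DERIV_chain2[where f = \<sigma>, THEN DERIV_cong])
    show "((\<lambda>t. (mat_upd W0 i j t ** X) $ q $ l) has_real_derivative
        (if q = i then X $ j $ l else 0)) (at (W0 $ i $ j))"
      unfolding mat_upd_mult_nth by (auto intro!: derivative_eq_intros)
  \<comment> \<open>At the base point \<open>mat_upd_same\<close> restores \<open>W0\<close>, so the
    outer derivative is evaluated at \<open>W0 ** X\<close> and gives \<open>D\<close>.\<close>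
  qed (auto simp: D_def mat_map_def mat_upd_same intro: \<sigma>)
  have "((\<lambda>t. (Y - W1 ** mat_map \<sigma> (mat_upd W0 i j t ** X)) $ k $ l) has_real_derivative
      - (W1 $ k $ i * (D $ i $ l * X $ j $ l))) (at (W0 $ i $ j))" for k l
  proof -
    have "((\<lambda>t. Y $ k $ l - (\<Sum>q\<in>UNIV. W1 $ k $ q * \<sigma> ((mat_upd W0 i j t ** X) $ q $ l)))
        has_real_derivative
        0 - (\<Sum>q\<in>UNIV. W1 $ k $ q * (if q = i then D $ i $ l * X $ j $ l else 0))) (at (W0 $ i $ j))"
      by (intro DERIV_diff DERIV_const DERIV_sum DERIV_cmult hidden)
    then show ?thesis
      by (simp add: matrix_matrix_mult_def[of W1] mat_map_def if_distrib cong: if_cong)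
  qed
  note DERIV_half_norm_power2_matrix[OF this]
  \<comment> \<open>Swapping the sums puts \<open>l\<close> outside: the inner sum over
    \<open>k\<close> is the product with \<open>transpose W1\<close>, the outer one the product with
    \<open>transpose X\<close>.\<close>
  moreover have "(\<Sum>k\<in>UNIV. \<Sum>l\<in>UNIV. (Y - P) $ k $ l * - (W1 $ k $ i * (D $ i $ l * X $ j $ l))) =
      ((D * (transpose W1 ** (P - Y))) ** transpose X) $ i $ j"
    unfolding matrix_matrix_mult_def[of "D * _"] matrix_matrix_mult_def[of "transpose W1"]
    by (subst sum.swap)
      (simp add: transpose_def sum_distrib_left sum_distrib_right algebra_simps)
  ultimately show "((\<lambda>t. 1 / 2 * (norm (Y - W1 ** mat_map \<sigma> (mat_upd W0 i j t ** X)))\<^sup>2)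
      has_real_derivative ((mat_map (deriv \<sigma>) (W0 ** X) *
        (transpose W1 ** (W1 ** mat_map \<sigma> (W0 ** X) - Y))) ** transpose X) $ i $ j)
      (at (W0 $ i $ j))"
    by (simp add: P_def D_def mat_upd_same)
qed

text \<open>Stationarity is stated through the gradient relation; uniqueness turns it into an
  equation for the explicit gradient.\<close>

lemma has_mat_gradient_zero_iff:
  assumes "has_mat_gradient F G W"
  shows "has_mat_gradient F 0 W \<longleftrightarrow> G = 0"
  using assms has_mat_gradient_unique by blast

lemma global_minimum_loss_exact_fit:
  assumes "W1 ** mat_map \<sigma> (W0 ** X) = Y"
  shows "global_minimum (loss \<sigma> X Y) W1 W0"
  using assms by (simp add: global_minimum_def loss_def)

theorem theorem1:
  fixes X :: "real ^ 'd ^ 'n" and Y :: "real ^ 'd ^ 'm" and \<sigma> :: "real \<Rightarrow> real"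
    and W1 :: "real ^ 'r ^ 'm" and W0 :: "real ^ 'n ^ 'r"
  assumes "\<And>x. \<sigma> differentiable (at x)"
  shows "has_mat_gradient (\<lambda>V. loss \<sigma> X Y V W0)
           ((W1 ** mat_map \<sigma> (W0 ** X) - Y) ** transpose (mat_map \<sigma> (W0 ** X))) W1 \<and>
         has_mat_gradient (\<lambda>V. loss \<sigma> X Y W1 V)
           ((mat_map (deriv \<sigma>) (W0 ** X) *
              (transpose W1 ** (W1 ** mat_map \<sigma> (W0 ** X) - Y))) ** transpose X) W0 \<and>
         (first_order_stationary (loss \<sigma> X Y) W1 W0 \<longleftrightarrow>
            W1 ** mat_map \<sigma> (W0 ** X) = Y \<or>
            (W1 ** mat_map \<sigma> (W0 ** X) \<noteq> Y \<and>
             mat_orthogonal (mat_map (deriv \<sigma>) (W0 ** X) *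
               (transpose W1 ** (W1 ** mat_map \<sigma> (W0 ** X) - Y))) (transpose X) \<and>
             mat_orthogonal (W1 ** mat_map \<sigma> (W0 ** X) - Y)
               (transpose (mat_map \<sigma> (W0 ** X))))) \<and>
         (W1 ** mat_map \<sigma> (W0 ** X) = Y \<longrightarrow> global_minimum (loss \<sigma> X Y) W1 W0)"
proof -
  note outer = loss_gradient_outer[of \<sigma> X Y W0 W1]
  note inner = loss_gradient_inner[OF assms, of X Y W1 W0]
  \<comment> \<open>These are the shapes in which a zero residual enters the two gradient
    blocks.\<close>
  have zero: "A ** (0 :: real ^ 'd ^ 'm) = 0" "(0 :: real ^ 'd ^ 'm) ** B = 0" "(0 :: real ^ 'd ^ 'r) ** C = 0"
    for A :: "real ^ 'm ^ 'r" and B :: "real ^ 'r ^ 'd" and C :: "real ^ 'n ^ 'd"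
    by (simp_all add: matrix_matrix_mult_def vec_eq_iff)
  show ?thesis
    using outer inner global_minimum_loss_exact_fit[of W1 \<sigma> W0 X Y]
    by (auto simp: first_order_stationary_def mat_orthogonal_iff zero
        has_mat_gradient_zero_iff[OF outer] has_mat_gradient_zero_iff[OF inner])
qed

end
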